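(* Let $k$ be a field, let $G$ be a connected finite simple graph with vertex set $V(G)=\{x_1,\dots,x_n\}$, let $R=k[x_1,\dots,x_n]$, and let $I=I(G)\subseteq R$ be the edge ideal of $G$. If there exist $u,v\in V(G)$ with $d(u,v)=d$, then $$\operatorname{depth} R/I\ \geq\ \left\lceil \frac{d+1}{3}\right\rceil .$$
   Context: Simple graph: no loops and no multiple edges. Vertices of $G$ are identified with the variables of $R$. The edge ideal $I(G)$ is the ideal of $R$ generated by the monomials $x_ix_j$ with $\{x_i,x_j\}\in E(G)$. The distance $d(u,v)$ is the length (number of edges) of a shortest path between $u$ and $v$. For a homogeneous ideal $J$ of $R$, $\operatorname{depth} R/J$ is the maximum length of an $R/J$-regular sequence in $\mathfrak m=(x_1,\dots,x_n)$. *)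

theory Defs
  imports Complex_Main "HOL-Library.Poly_Mapping" "HOL-Library.Extended_Nat"
begin

text \<open>
  A graph has the finite type \<open>'v\<close> as its vertex set and a set \<open>E\<close> of two-element subsets as its
  edges. The elements of \<open>'v\<close> also index the variables of the polynomial ring.
\<close>

definition simple_graph :: "'v set set \<Rightarrow> bool" where
  "simple_graph E \<longleftrightarrow> (\<forall>e\<in>E. card e = 2)"

definition is_path :: "'v set set \<Rightarrow> 'v \<Rightarrow> 'v list \<Rightarrow> 'v \<Rightarrow> bool" where
  "is_path E u p v \<longleftrightarrow>
     p \<noteq> [] \<and> hd p = u \<and> last p = v \<and> distinct p \<and> successively (\<lambda>x y. {x, y} \<in> E) p"

definition connected_graph :: "'v set set \<Rightarrow> bool" where
  "connected_graph E \<longleftrightarrow> (\<forall>u v. \<exists>p. is_path E u p v)"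

text \<open>
  The length of a path is its number of edges. The value is meaningful only if \<open>u\<close> and \<open>v\<close> are
  joined by a path, as is always the case in a connected graph.
\<close>

definition graph_dist :: "'v set set \<Rightarrow> 'v \<Rightarrow> 'v \<Rightarrow> nat" where
  "graph_dist E u v = (LEAST l. \<exists>p. is_path E u p v \<and> l = length p - 1)"

text \<open>A monomial is given by its exponents, so this type is the ring \<open>k[x\<^sub>v : v \<in> 'v]\<close>.\<close>

type_synonym ('v, 'k) mpoly = "('v \<Rightarrow>\<^sub>0 nat) \<Rightarrow>\<^sub>0 'k"

definition var :: "'v \<Rightarrow> ('v, 'k::comm_ring_1) mpoly" where
  "var v = Poly_Mapping.single (Poly_Mapping.single v 1) 1"

text \<open>Ideals are the submodules of a ring regarded as a module over itself.\<close>

definition ideal_gen :: "'a::comm_ring_1 set \<Rightarrow> 'a set" where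
  "ideal_gen S = module.span (*) S"

definition max_ideal :: "('v, 'k::comm_ring_1) mpoly set" where
  "max_ideal = ideal_gen (range var)"

definition edge_ideal :: "'v set set \<Rightarrow> ('v, 'k::comm_ring_1) mpoly set" where
  "edge_ideal E = ideal_gen {var u * var v |u v. {u, v} \<in> E}"

text \<open>
  The sequence \<open>f\<^sub>1, \<dots>, f\<^sub>r\<close> is \<open>R/J\<close>-regular if each \<open>f\<^sub>i\<close> is a nonzerodivisor on
  \<open>R/(J + (f\<^sub>1, \<dots>, f\<^bsub>i-1\<^esub>))\<close> and \<open>R/(J + (f\<^sub>1, \<dots>, f\<^sub>r))\<close> is not zero. The classes modulo an ideal
  are expressed by membership in that ideal.
\<close>

definition nonzerodivisor_mod :: "'a::comm_ring_1 set \<Rightarrow> 'a \<Rightarrow> bool" where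
  "nonzerodivisor_mod K f \<longleftrightarrow> (\<forall>g. f * g \<in> K \<longrightarrow> g \<in> K)"

definition regular_seq_mod :: "'a::comm_ring_1 set \<Rightarrow> 'a list \<Rightarrow> bool" where
  "regular_seq_mod J fs \<longleftrightarrow>
     (\<forall>i<length fs. nonzerodivisor_mod (ideal_gen (J \<union> set (take i fs))) (fs ! i)) \<and>
     ideal_gen (J \<union> set fs) \<noteq> UNIV"

text \<open>
  The depth of \<open>R/J\<close>. The supremum is taken in \<^typ>\<open>enat\<close>, where it exists without a prior bound on
  the lengths. It is a maximum whenever the lengths are bounded.
\<close>

definition depth_quot :: "('v::finite, 'k::field) mpoly set \<Rightarrow> enat" where
  "depth_quot J = (SUP fs \<in> {fs. set fs \<subseteq> max_ideal \<and> regular_seq_mod J fs}. enat (length fs))"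

end

theory Submission imports Defs "HOL-Library.Disjoint_Sets" begin

text \<open>
  On a shortest path from \<open>u\<close> to \<open>v\<close>, the vertices at distance \<open>0, 3, 6, \<dots>\<close> from \<open>u\<close> have pairwise
  disjoint closed neighbourhoods, and the sums \<open>\<theta>\<^sub>i\<close> of the variables in these neighbourhoods form
  a regular sequence on \<open>R/I\<close>. More generally, let \<open>I\<close> be the ideal of a hypergraph and let \<open>S\<^sub>i\<close> be
  disjoint sets of vertices such that \<open>S\<^sub>i\<close> contains all edges through some \<open>c\<^sub>i \<in> S\<^sub>i\<close>. For a
  variable \<open>b\<close> other than the \<open>c\<^sub>i\<close>, the ideals \<open>I : b\<close> and \<open>I + (b)\<close> have the same form (if
  \<open>{c\<^sub>i, b}\<close> is an edge, \<open>b\<close> takes over the role of \<open>c\<^sub>i\<close> in \<open>I : b\<close>), and a sequence that is regular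
  modulo both is regular modulo \<open>I\<close>. The induction ends when no minimal edge contains any \<open>c\<^sub>i\<close>;
  then \<open>\<theta>\<^sub>i\<close> is \<open>c\<^sub>i\<close> plus terms free of \<open>c\<^sub>i\<close>, while \<open>I\<close> and the other \<open>\<theta>\<^sub>j\<close> do not involve \<open>c\<^sub>i\<close>.
\<close>

text \<open>Keeps exponents in the form \<open>1\<close>; simp would turn \<open>single c 1\<close>
  into \<open>single c (Suc 0)\<close>.\<close>

declare One_nat_def [simp del]

section \<open>Ideals and weakly regular sequences\<close>

lemma module_mult: "module ((*) :: 'a::comm_ring_1 \<Rightarrow> 'a \<Rightarrow> 'a)"
  by unfold_locales (simp_all add: algebra_simps)

lemma ideal_gen_subset_iff:
  "ideal_gen J \<subseteq> ideal_gen K \<longleftrightarrow> J \<subseteq> ideal_gen K"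
  unfolding ideal_gen_def
  by (meson module.span_minimal[OF module_mult] module.span_superset[OF module_mult]
      module.subspace_span[OF module_mult] subset_trans)

lemma ideal_gen_superset: "x \<in> J \<Longrightarrow> x \<in> ideal_gen J"
  unfolding ideal_gen_def by (rule module.span_base[OF module_mult])

lemma ideal_gen_mult: "x \<in> ideal_gen J \<Longrightarrow> r * x \<in> ideal_gen J"
  unfolding ideal_gen_def by (rule module.span_scale[OF module_mult])

lemma ideal_gen_add: "x \<in> ideal_gen J \<Longrightarrow> y \<in> ideal_gen J \<Longrightarrow> x + y \<in> ideal_gen J"
  unfolding ideal_gen_def by (rule module.span_add[OF module_mult])

lemma ideal_gen_diff: "x \<in> ideal_gen J \<Longrightarrow> y \<in> ideal_gen J \<Longrightarrow> x - y \<in> ideal_gen J"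
  unfolding ideal_gen_def by (rule module.span_diff[OF module_mult])

lemma ideal_gen_insert_iff:
  "h \<in> ideal_gen (insert f J) \<longleftrightarrow> (\<exists>k. h - k * f \<in> ideal_gen J)"
  unfolding ideal_gen_def by (rule module.span_breakdown_eq[OF module_mult])

text \<open>Properness is left out: containment in \<open>max_ideal\<close> settles it once at the
  end, and the inductions carry only the nonzerodivisor conditions.\<close>

definition weakly_regular_mod :: "'a::comm_ring_1 set \<Rightarrow> 'a list \<Rightarrow> bool" where
  "weakly_regular_mod J fs \<longleftrightarrow>
     (\<forall>i<length fs. nonzerodivisor_mod (ideal_gen (J \<union> set (take i fs))) (fs ! i))"

lemma weakly_regular_mod_Nil [simp]: "weakly_regular_mod J []"
  by (simp add: weakly_regular_mod_def)

lemma weakly_regular_mod_Cons [simp]: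
  "weakly_regular_mod J (f # fs) \<longleftrightarrow>
     nonzerodivisor_mod (ideal_gen J) f \<and> weakly_regular_mod (insert f J) fs"
  by (simp add: weakly_regular_mod_def All_less_Suc2)

text \<open>
  With \<open>I = ideal_gen J\<close>, this is the step along \<open>0 \<rightarrow> R/(I : b) \<rightarrow> R/I \<rightarrow> R/(I + (b)) \<rightarrow> 0\<close>:
  the sequence stays exact modulo \<open>f\<close> because \<open>f\<close> is a nonzerodivisor on the right-hand term.
\<close>

lemma weakly_regular_mod_colon:
  assumes "\<And>h. b * h \<in> ideal_gen J \<longleftrightarrow> h \<in> ideal_gen L"
    and "weakly_regular_mod L fs" and "weakly_regular_mod (insert b J) fs"
  shows "weakly_regular_mod J fs"
  using assms
proof (induction fs arbitrary: J L)
  case (Cons f fs)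
  have nzL: "g \<in> ideal_gen L" if "f * g \<in> ideal_gen L" for g
    using Cons.prems(2) that by (auto simp: nonzerodivisor_mod_def)
  have div_b: "\<exists>k. g - k * b \<in> ideal_gen J" if "f * g - k * b \<in> ideal_gen J" for g k
    using Cons.prems(3) that by (auto simp: nonzerodivisor_mod_def ideal_gen_insert_iff)
  have "g \<in> ideal_gen J" if fg: "f * g \<in> ideal_gen J" for g
  proof -
    obtain k where k: "g - k * b \<in> ideal_gen J"
      using div_b[of g 0] fg by auto
    \<comment> \<open>Both terms on the right lie in the ideal of \<open>J\<close>, so
      \<open>f * k\<close> lies in that of \<open>L\<close>, where \<open>f\<close> cancels.\<close>
    have "b * (f * k) = f * g - f * (g - k * b)"
      by (simp add: right_diff_distrib ac_simps)
    also have "\<dots> \<in> ideal_gen J"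
      by (intro ideal_gen_diff ideal_gen_mult k fg)
    finally have "b * (f * k) \<in> ideal_gen J" .
    then have "f * k \<in> ideal_gen L"
      by (simp only: Cons.prems(1))
    then have "b * k \<in> ideal_gen J"
      unfolding Cons.prems(1) by (rule nzL)
    from ideal_gen_add[OF k this] show ?thesis
      by (simp add: algebra_simps)
  qed
  then have nzJ: "nonzerodivisor_mod (ideal_gen J) f"
    by (simp add: nonzerodivisor_mod_def)
  \<comment> \<open>For the induction on \<open>fs\<close>, the colon relation must survive
    adjoining \<open>f\<close> to both \<open>J\<close> and \<open>L\<close>.\<close>
  have colon: "b * h \<in> ideal_gen (insert f J) \<longleftrightarrow> h \<in> ideal_gen (insert f L)" for h
  proof
    assume "b * h \<in> ideal_gen (insert f J)"
    then obtain g where g: "b * h - g * f \<in> ideal_gen J"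
      by (auto simp: ideal_gen_insert_iff)
    \<comment> \<open>Modulo \<open>J\<close> and \<open>b\<close>, \<open>f\<close> kills
      \<open>g\<close>, so \<open>g\<close> is a multiple of \<open>b\<close> modulo
      \<open>J\<close>; then \<open>b\<close> factors out of \<open>b * h - g * f\<close>.\<close>
    have "f * g - h * b \<in> ideal_gen J"
      using ideal_gen_mult[OF g, of "- 1"] by (simp add: algebra_simps)
    then obtain k where k: "g - k * b \<in> ideal_gen J"
      using div_b by blast
    have "b * (h - k * f) \<in> ideal_gen J"
      using ideal_gen_add[OF g ideal_gen_mult[OF k, of f]] by (simp add: algebra_simps)
    then show "h \<in> ideal_gen (insert f L)"
      unfolding Cons.prems(1) ideal_gen_insert_iff by blast
  next
    assume "h \<in> ideal_gen (insert f L)"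
    then obtain k where "b * (h - k * f) \<in> ideal_gen J"
      unfolding Cons.prems(1) ideal_gen_insert_iff by blast
    then have "b * h - (b * k) * f \<in> ideal_gen J"
      by (simp add: algebra_simps)
    then show "b * h \<in> ideal_gen (insert f J)"
      unfolding ideal_gen_insert_iff by blast
  qed
  have "weakly_regular_mod (insert f J) fs"
    using Cons.prems by (intro Cons.IH[OF colon]) (simp_all add: insert_commute)
  with nzJ show ?case
    by simp
qed simp

section \<open>Polynomials as sums of terms, and squarefree monomial ideals\<close>

lemma sum_single_lookup:
  "(\<Sum>k\<in>Poly_Mapping.keys f. Poly_Mapping.single k (Poly_Mapping.lookup f k)) = f"
  by (intro poly_mapping_eqI) (simp add: lookup_sum lookup_single when_def in_keys_iff)

text \<open>The zero polynomial falls under the case \<open>single\<close>, with coefficient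
  \<open>0\<close>.\<close>

lemma poly_mapping_add_induct [case_names single add]:
  fixes f :: "'a \<Rightarrow>\<^sub>0 'b::comm_monoid_add"
  assumes single: "\<And>k a. P (Poly_Mapping.single k a)"
    and add: "\<And>f g. P f \<Longrightarrow> P g \<Longrightarrow> P (f + g)"
  shows "P f"
proof -
  have "P (\<Sum>k\<in>A. Poly_Mapping.single k (Poly_Mapping.lookup f k))" if "finite A" for A
    using that
  proof (induction A)
    case empty
    show ?case
      using single[of _ 0] by simp
  qed (simp add: single add)
  then show ?thesis
    using sum_single_lookup[of f] finite_keys[of f] by metis
qed

definition sqfree_monom :: "'v set \<Rightarrow> ('v, 'k::comm_ring_1) mpoly" where
  "sqfree_monom e = (\<Prod>v\<in>e. var v)"

lemma sqfree_monom_eq_single: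
  assumes "finite e"
  shows "sqfree_monom e =
    Poly_Mapping.single (\<Sum>v\<in>e. Poly_Mapping.single v 1) (1 :: 'k::comm_ring_1)"
  unfolding sqfree_monom_def using assms
  by (induction e) (simp_all add: var_def mult_single)

lemma lookup_sum_single:
  "finite e \<Longrightarrow> Poly_Mapping.lookup (\<Sum>v\<in>e. Poly_Mapping.single v (1::nat)) x = of_bool (x \<in> e)"
  by (simp add: lookup_sum lookup_single when_def)

lemma keys_add_nat:
  fixes m n :: "'v \<Rightarrow>\<^sub>0 nat"
  shows "Poly_Mapping.keys (m + n) = Poly_Mapping.keys m \<union> Poly_Mapping.keys n"
  by (auto simp: in_keys_iff lookup_add)

text \<open>For a hypergraph \<open>E\<close>, this is the Stanley-Reisner ideal of the complex of its independent sets.\<close>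

definition nonface_ideal :: "'v set set \<Rightarrow> ('v, 'k::comm_ring_1) mpoly set" where
  "nonface_ideal E = {f. \<forall>m\<in>Poly_Mapping.keys f. \<exists>e\<in>E. e \<subseteq> Poly_Mapping.keys m}"

lemma subspace_nonface_ideal:
  "module.subspace (*) (nonface_ideal E :: ('v, 'k::comm_ring_1) mpoly set)"
proof (rule module.subspaceI[OF module_mult])
  fix f g :: "('v, 'k) mpoly"
  assume "f \<in> nonface_ideal E" "g \<in> nonface_ideal E"
  then show "f + g \<in> nonface_ideal E"
    using keys_add[of f g] by (fastforce simp: nonface_ideal_def)
next
  fix r f :: "('v, 'k) mpoly"
  assume f: "f \<in> nonface_ideal E"
  show "r * f \<in> nonface_ideal E"
    unfolding nonface_ideal_def
  proof (clarify)
    fix m assume "m \<in> Poly_Mapping.keys (r * f)"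
    then obtain a b where m: "m = a + b" and "b \<in> Poly_Mapping.keys f"
      using keys_mult[of r f] by blast
    then obtain e where "e \<in> E" "e \<subseteq> Poly_Mapping.keys b"
      using f by (auto simp: nonface_ideal_def)
    then show "\<exists>e\<in>E. e \<subseteq> Poly_Mapping.keys m"
      unfolding m keys_add_nat by blast
  qed
qed (simp add: nonface_ideal_def)

text \<open>Membership in a monomial ideal is decided term by term, and a squarefree monomial
  divides another monomial exactly when its support is contained in the other's.\<close>

lemma ideal_gen_sqfree_monom:
  fixes E :: "'v::finite set set"
  shows "ideal_gen (sqfree_monom ` E :: ('v, 'k::comm_ring_1) mpoly set) = nonface_ideal E"
proof
  have keys_sum: "Poly_Mapping.keys (\<Sum>v\<in>e. Poly_Mapping.single v (1::nat)) = e" for e :: "'v set"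
    by (auto simp: in_keys_iff lookup_sum_single)
  have "sqfree_monom ` E \<subseteq> (nonface_ideal E :: ('v, 'k) mpoly set)"
    using keys_sum by (auto simp: nonface_ideal_def sqfree_monom_eq_single)
  then show "ideal_gen (sqfree_monom ` E) \<subseteq> (nonface_ideal E :: ('v, 'k) mpoly set)"
    unfolding ideal_gen_def by (intro module.span_minimal[OF module_mult] subspace_nonface_ideal)
  show "(nonface_ideal E :: ('v, 'k) mpoly set) \<subseteq> ideal_gen (sqfree_monom ` E)"
  proof
    fix f :: "('v, 'k) mpoly"
    assume f: "f \<in> nonface_ideal E"
    have "Poly_Mapping.single m (Poly_Mapping.lookup f m) \<in> ideal_gen (sqfree_monom ` E)"
      if m: "m \<in> Poly_Mapping.keys f" for m
    proof -
      obtain e where e: "e \<in> E" "e \<subseteq> Poly_Mapping.keys m"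
        using f m by (auto simp: nonface_ideal_def)
      let ?x = "\<Sum>v\<in>e. Poly_Mapping.single v (1::nat)"
      \<comment> \<open>Subtraction of exponents is truncated; it is exact here because
        \<open>e\<close> lies in the support of \<open>m\<close>.\<close>
      have "m = (m - ?x) + ?x"
        using e(2) by (intro poly_mapping_eqI)
          (auto simp: lookup_add lookup_minus lookup_sum_single in_keys_iff of_bool_def)
      then have "Poly_Mapping.single m (Poly_Mapping.lookup f m) =
          Poly_Mapping.single (m - ?x) (Poly_Mapping.lookup f m) * sqfree_monom e"
        by (simp add: sqfree_monom_eq_single mult_single)
      then show ?thesis
        using e(1) by (simp add: ideal_gen_mult ideal_gen_superset)
    qed
    then have "(\<Sum>m\<in>Poly_Mapping.keys f. Poly_Mapping.single m (Poly_Mapping.lookup f m))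
        \<in> ideal_gen (sqfree_monom ` E)"
      unfolding ideal_gen_def by (rule module.span_sum[OF module_mult])
    then show "f \<in> ideal_gen (sqfree_monom ` E)"
      by (simp only: sum_single_lookup)
  qed
qed

section \<open>Division by a variable\<close>

text \<open>Drops the monomials without \<open>c\<close> and divides the remaining ones by \<open>c\<close>.\<close>

definition shift :: "'v \<Rightarrow> ('v, 'k::comm_ring_1) mpoly \<Rightarrow> ('v, 'k) mpoly" where
  "shift c = Poly_Mapping.map_key (\<lambda>m. m + Poly_Mapping.single c 1)"

lemma inj_add_single: "inj (\<lambda>m :: 'v \<Rightarrow>\<^sub>0 nat. m + Poly_Mapping.single c 1)"
  by (simp add: inj_def)

lemma lookup_shift:
  "Poly_Mapping.lookup (shift c g) m = Poly_Mapping.lookup g (m + Poly_Mapping.single c 1)"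
  using inj_add_single[of c] by (simp add: shift_def map_key.rep_eq)

lemma shift_add: "shift c (f + g) = shift c f + shift c g"
  by (intro poly_mapping_eqI) (simp add: lookup_shift lookup_add)

lemma shift_diff: "shift c (f - g) = shift c f - shift c g"
  by (intro poly_mapping_eqI) (simp add: lookup_shift lookup_minus)

lemma shift_zero [simp]: "shift c 0 = 0"
  by (intro poly_mapping_eqI) (simp add: lookup_shift)

lemma shift_single_add:
  "shift c (Poly_Mapping.single (m + Poly_Mapping.single c 1) a) = Poly_Mapping.single m a"
  by (intro poly_mapping_eqI) (simp add: lookup_shift lookup_single when_def)

lemma shift_single_eq_0:
  assumes "Poly_Mapping.lookup m c = 0"
  shows "shift c (Poly_Mapping.single m a) = 0"
  using assms
  by (intro poly_mapping_eqI) (auto simp: lookup_shift lookup_single when_def lookup_add)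

lemma shift_var_mult: "shift c (var c * g) = g"
proof (induction g rule: poly_mapping_add_induct)
  case (single k v)
  show ?case
    by (simp add: var_def mult_single shift_single_add add.commute[of "Poly_Mapping.single c _"])
next
  case (add f g)
  then show ?case
    by (simp add: distrib_left shift_add)
qed

text \<open>Only monomials with exponent at least \<open>n\<close> in \<open>c\<close> survive
  \<open>n\<close> shifts, and \<open>g\<close> has finitely many monomials.\<close>

lemma shift_funpow_eventually_0: "\<exists>n. (shift c ^^ n) g = 0"
proof -
  have lookup_pow: "Poly_Mapping.lookup ((shift c ^^ n) g) m =
      Poly_Mapping.lookup g (m + Poly_Mapping.single c n)" for n m
    by (induction n arbitrary: m)
      (simp_all add: lookup_shift add.assoc plus_1_eq_Suc flip: single_add)
  obtain n where n: "Poly_Mapping.lookup m c < n" if "m \<in> Poly_Mapping.keys g" for m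
    using finite_nat_set_iff_bounded[of "(\<lambda>m. Poly_Mapping.lookup m c) ` Poly_Mapping.keys g"]
    by auto
  have "(shift c ^^ n) g = 0"
  proof (intro poly_mapping_eqI)
    fix m
    show "Poly_Mapping.lookup ((shift c ^^ n) g) m = Poly_Mapping.lookup 0 m"
      using n[of "m + Poly_Mapping.single c n"]
      by (auto simp: lookup_pow lookup_add in_keys_iff)
  qed
  then show ?thesis ..
qed

text \<open>In effect, \<open>l\<close> does not involve the variable \<open>c\<close>.\<close>

definition shift_linear :: "'v \<Rightarrow> ('v, 'k::comm_ring_1) mpoly \<Rightarrow> bool" where
  "shift_linear c l \<longleftrightarrow> (\<forall>g. shift c (l * g) = l * shift c g)"

lemma shift_linear_add: "shift_linear c l \<Longrightarrow> shift_linear c l' \<Longrightarrow> shift_linear c (l + l')"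
  by (simp add: shift_linear_def distrib_right shift_add)

lemma shift_linear_var:
  assumes "v \<noteq> c"
  shows "shift_linear c (var v :: ('v, 'k::comm_ring_1) mpoly)"
  unfolding shift_linear_def
proof
  fix g :: "('v, 'k) mpoly"
  show "shift c (var v * g) = var v * shift c g"
  proof (induction g rule: poly_mapping_add_induct)
    case (single m a)
    show ?case
    proof (cases "Poly_Mapping.lookup m c = 0")
      case True
      then show ?thesis
        using assms by (simp add: var_def mult_single shift_single_eq_0 lookup_add lookup_single)
    next
      case False
      then have "m = (m - Poly_Mapping.single c 1) + Poly_Mapping.single c 1"
        by (intro poly_mapping_eqI) (auto simp: lookup_add lookup_minus lookup_single when_def)
      then obtain n where n: "m = n + Poly_Mapping.single c 1" ..
      show ?thesis
        unfolding n var_def shift_single_add mult_single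
        by (simp only: shift_single_add flip: add.assoc)
    qed
  next
    case (add f g)
    then show ?case
      by (simp add: distrib_left shift_add)
  qed
qed

lemma shift_linear_sum_var:
  "finite S \<Longrightarrow> c \<notin> S \<Longrightarrow> shift_linear c (\<Sum>v\<in>S. var v)"
  by (induction S rule: finite_induct)
    (auto simp: shift_linear_def[of _ 0] intro!: shift_linear_add shift_linear_var)

text \<open>Shifting \<open>(var c + l) * g\<close> repeatedly gives
  \<open>(shift c ^^ j) g = - l * (shift c ^^ Suc j) g\<close> modulo \<open>J\<close>. High
  iterates vanish, so descending induction on \<open>j\<close> reaches \<open>g\<close>
  itself.\<close>

lemma nonzerodivisor_mod_var_add:
  assumes stable: "\<And>g. g \<in> ideal_gen J \<Longrightarrow> shift c g \<in> ideal_gen J"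
    and l: "shift_linear c l"
  shows "nonzerodivisor_mod (ideal_gen J) (var c + l)"
  unfolding nonzerodivisor_mod_def
proof (intro allI impI)
  fix g assume "(var c + l) * g \<in> ideal_gen J"
  from stable[OF this] have step: "(shift c ^^ j) g + l * (shift c ^^ Suc j) g \<in> ideal_gen J" for j
  proof (induction j)
    case (Suc j)
    from stable[OF Suc.IH] Suc.prems l show ?case
      by (simp add: shift_add shift_linear_def)
  qed (use l in \<open>simp add: distrib_right shift_add shift_var_mult shift_linear_def\<close>)
  obtain n where n: "(shift c ^^ n) g = 0"
    using shift_funpow_eventually_0[of c g] by blast
  have "(shift c ^^ 0) g \<in> ideal_gen J"
  proof (rule inc_induct[of 0 n])
    show "(shift c ^^ n) g \<in> ideal_gen J"
      by (simp add: n ideal_gen_def module.span_zero[OF module_mult])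
  next
    fix j assume "(shift c ^^ Suc j) g \<in> ideal_gen J"
    from ideal_gen_diff[OF step ideal_gen_mult[OF this]]
    show "(shift c ^^ j) g \<in> ideal_gen J"
      by (metis add_diff_cancel_right')
  qed simp
  then show "g \<in> ideal_gen J"
    by simp
qed

text \<open>By disjointness the sum over \<open>S i\<close> is free of \<open>c j\<close> for the
  other \<open>j\<close>, so stability under \<open>shift (c j)\<close> persists when that sum is
  adjoined to \<open>J\<close>.\<close>

lemma weakly_regular_mod_shift_stable:
  fixes S :: "'i \<Rightarrow> 'v::finite set" and J :: "('v, 'k::comm_ring_1) mpoly set"
  assumes "distinct is" and "disjoint_family_on S (set is)"
    and "\<And>i. i \<in> set is \<Longrightarrow> c i \<in> S i"
    and "\<And>i g. i \<in> set is \<Longrightarrow> g \<in> ideal_gen J \<Longrightarrow> shift (c i) g \<in> ideal_gen J"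
  shows "weakly_regular_mod J (map (\<lambda>i. \<Sum>v\<in>S i. var v) is)"
  using assms
proof (induction "is" arbitrary: J)
  case (Cons i "is")
  let ?\<theta> = "\<Sum>v\<in>S i. var v :: ('v, 'k) mpoly"
  have "?\<theta> = var (c i) + (\<Sum>v\<in>S i - {c i}. var v)"
    using Cons.prems(3)[of i] by (simp add: sum.remove[of "S i" "c i"])
  then have nz: "nonzerodivisor_mod (ideal_gen J) ?\<theta>"
    using Cons.prems(4)[of i] by (simp add: nonzerodivisor_mod_var_add shift_linear_sum_var)
  have stable: "shift (c j) g \<in> ideal_gen (insert ?\<theta> J)"
    if j: "j \<in> set is" and g: "g \<in> ideal_gen (insert ?\<theta> J)" for j g
  proof -
    have "c j \<in> S j" "S i \<inter> S j = {}"
      using Cons.prems j by (auto simp: disjoint_family_on_def)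
    then have "c j \<notin> S i"
      by blast
    then have lin: "shift_linear (c j) ?\<theta>"
      by (simp add: shift_linear_sum_var)
    obtain k where "g - k * ?\<theta> \<in> ideal_gen J"
      using g by (auto simp: ideal_gen_insert_iff)
    then have "shift (c j) (g - ?\<theta> * k) \<in> ideal_gen J"
      using Cons.prems(4)[of j] j by (simp add: mult.commute)
    then have "shift (c j) g - shift (c j) k * ?\<theta> \<in> ideal_gen J"
      using lin by (simp add: shift_diff shift_linear_def mult.commute)
    then show ?thesis
      by (auto simp: ideal_gen_insert_iff)
  qed
  have "weakly_regular_mod (insert ?\<theta> J) (map (\<lambda>i. \<Sum>v\<in>S i. var v) is)"
    using Cons.prems stable by (intro Cons.IH) (auto simp: disjoint_family_on_def)
  with nz show ?case
    by simp
qed simp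

section \<open>Colon ideals by a variable and the induction over hypergraphs\<close>

lemma var_mult_mem_nonface_ideal_iff:
  "var b * h \<in> nonface_ideal E \<longleftrightarrow> h \<in> nonface_ideal ((\<lambda>e. e - {b}) ` E)"
proof
  assume L: "var b * h \<in> nonface_ideal E"
  show "h \<in> nonface_ideal ((\<lambda>e. e - {b}) ` E)"
    unfolding nonface_ideal_def
  proof clarify
    fix m assume "m \<in> Poly_Mapping.keys h"
    \<comment> \<open>By \<open>shift_var_mult\<close>, this monomial has the same coefficient in
      \<open>var b * h\<close> as \<open>m\<close> has in \<open>h\<close>.\<close>
    then have "m + Poly_Mapping.single b 1 \<in> Poly_Mapping.keys (var b * h)"
      by (simp add: in_keys_iff shift_var_mult flip: lookup_shift)
    then obtain e where "e \<in> E" "e \<subseteq> Poly_Mapping.keys (m + Poly_Mapping.single b 1)"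
      using L by (auto simp: nonface_ideal_def)
    then show "\<exists>e\<in>(\<lambda>e. e - {b}) ` E. e \<subseteq> Poly_Mapping.keys m"
      by (auto simp: keys_add_nat)
  qed
next
  assume R: "h \<in> nonface_ideal ((\<lambda>e. e - {b}) ` E)"
  show "var b * h \<in> nonface_ideal E"
    unfolding nonface_ideal_def
  proof clarify
    fix m assume "m \<in> Poly_Mapping.keys (var b * h)"
    then obtain n where m: "m = Poly_Mapping.single b 1 + n" and "n \<in> Poly_Mapping.keys h"
      using keys_mult[of "var b" h] by (auto simp: var_def split: if_splits)
    then obtain e where "e \<in> E" "e - {b} \<subseteq> Poly_Mapping.keys n"
      using R by (auto simp: nonface_ideal_def)
    then show "\<exists>e\<in>E. e \<subseteq> Poly_Mapping.keys m"
      by (intro bexI[of _ e]) (auto simp: m keys_add_nat)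
  qed
qed

text \<open>The induction measure counts the vertices on edges that do not form a singleton edge;
  both passing to the colon ideal by \<open>b\<close> and adjoining \<open>b\<close> remove
  \<open>b\<close> from this set.\<close>

lemma weakly_regular_mod_packing:
  fixes S :: "'i \<Rightarrow> 'v::finite set" and E :: "'v set set"
  assumes "distinct is" and "disjoint_family_on S (set is)"
    and "\<And>i. i \<in> set is \<Longrightarrow> c i \<in> S i"
    and "\<And>i. i \<in> set is \<Longrightarrow> {c i} \<notin> E"
    and "\<And>i e. i \<in> set is \<Longrightarrow> e \<in> E \<Longrightarrow> c i \<in> e \<Longrightarrow> e \<subseteq> S i"
  shows "weakly_regular_mod (sqfree_monom ` E :: ('v, 'k::comm_ring_1) mpoly set)
           (map (\<lambda>i. \<Sum>v\<in>S i. var v) is)"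
  using assms
proof (induction "card {b \<in> \<Union>E. {b} \<notin> E}" arbitrary: E c rule: less_induct)
  case less
  show ?case
  \<comment> \<open>In the negative case, every edge through a \<open>c i\<close> has another vertex
    \<open>b\<close> with \<open>{b}\<close> in \<open>E\<close>, so it is not minimal.\<close>
  proof (cases "\<exists>i\<in>set is. \<exists>e\<in>E. c i \<in> e \<and> (\<forall>b\<in>e - {c i}. {b} \<notin> E)")
    case True
    then obtain i e where i: "i \<in> set is" and e: "e \<in> E" "c i \<in> e" "\<forall>b\<in>e - {c i}. {b} \<notin> E"
      by blast
    have "e \<noteq> {c i}"
      using less.prems(4)[OF i] e(1) by blast
    then obtain b where b: "b \<in> e" "b \<noteq> c i"
      using e(2) by blast
    then have bE: "{b} \<notin> E"
      using e(3) by blast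
    have "b \<in> S i"
      using less.prems(5)[OF i e(1,2)] b(1) by blast
    \<comment> \<open>This ensures that adjoining \<open>{b}\<close> creates no edge through any
      \<open>c j\<close>.\<close>
    have bc: "b \<noteq> c j" if j: "j \<in> set is" for j
    proof (cases "j = i")
      case False
      then have "S i \<inter> S j = {}"
        using less.prems(2) i j by (simp add: disjoint_family_on_def)
      with \<open>b \<in> S i\<close> less.prems(3)[OF j] show ?thesis
        by blast
    qed (use b(2) in simp)
    let ?E' = "(\<lambda>e. e - {b}) ` E"
    \<comment> \<open>Deleting \<open>b\<close> would turn an edge \<open>{c j, b}\<close> into the
      forbidden \<open>{c j}\<close>. In that case \<open>b\<close> lies in \<open>S j\<close> and
      in no edge of \<open>?E'\<close>, so it meets the hypotheses.\<close>
    let ?c' = "\<lambda>j. if {c j, b} \<in> E then b else c j"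
    show ?thesis
    proof (rule weakly_regular_mod_colon)
      fix h :: "('v, 'k) mpoly"
      show "var b * h \<in> ideal_gen (sqfree_monom ` E) \<longleftrightarrow> h \<in> ideal_gen (sqfree_monom ` ?E')"
        by (simp only: ideal_gen_sqfree_monom var_mult_mem_nonface_ideal_iff)
    next
      \<comment> \<open>\<open>b\<close> is gone from all edges, while every singleton edge of
        \<open>E\<close> remains an edge.\<close>
      have "{x \<in> \<Union>?E'. {x} \<notin> ?E'} \<subset> {x \<in> \<Union>E. {x} \<notin> E}"
      proof
        show "{x \<in> \<Union>?E'. {x} \<notin> ?E'} \<subseteq> {x \<in> \<Union>E. {x} \<notin> E}"
        proof
          fix x assume "x \<in> {x \<in> \<Union>?E'. {x} \<notin> ?E'}"
          then have x: "x \<in> \<Union>E" "x \<noteq> b" "{x} \<notin> ?E'"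
            by auto
          then have "{x} \<notin> E"
            by (auto simp: image_iff)
          with x show "x \<in> {x \<in> \<Union>E. {x} \<notin> E}"
            by blast
        qed
        show "{x \<in> \<Union>?E'. {x} \<notin> ?E'} \<noteq> {x \<in> \<Union>E. {x} \<notin> E}"
          using b(1) bE e(1) by blast
      qed
      then have card: "card {x \<in> \<Union>?E'. {x} \<notin> ?E'} < card {x \<in> \<Union>E. {x} \<notin> E}"
        by (intro psubset_card_mono) simp_all
      show "weakly_regular_mod (sqfree_monom ` ?E' :: ('v, 'k) mpoly set)
          (map (\<lambda>i. \<Sum>v\<in>S i. var v) is)"
      proof (rule less.hyps[OF card, where c = ?c'])
        fix j assume j: "j \<in> set is"
        show "?c' j \<in> S j"
          using less.prems(3,5)[OF j] by auto
        show "{?c' j} \<notin> ?E'"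
        proof
          assume "{?c' j} \<in> ?E'"
          then obtain y where y: "y \<in> E" "y - {b} = {?c' j}"
            by blast
          then have "?c' j \<noteq> b"
            by blast
          then have cj: "{c j, b} \<notin> E" "y - {b} = {c j}"
            using y(2) by presburger+
          then have "y = {c j} \<or> y = {c j, b}"
            by blast
          with y(1) cj(1) less.prems(4)[OF j] show False
            by blast
        qed
        fix y assume y: "y \<in> ?E'" "?c' j \<in> y"
        then have "?c' j \<noteq> b"
          by blast
        then have "c j \<in> y"
          using y(2) by presburger
        then show "y \<subseteq> S j"
          using y(1) less.prems(5)[OF j] by blast
      qed (fact less.prems)+
    next
      have "{x \<in> \<Union>(insert {b} E). {x} \<notin> insert {b} E} \<subset> {x \<in> \<Union>E. {x} \<notin> E}"
        using b(1) bE e(1) by blast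
      then have card: "card {x \<in> \<Union>(insert {b} E). {x} \<notin> insert {b} E}
          < card {x \<in> \<Union>E. {x} \<notin> E}"
        by (intro psubset_card_mono) simp_all
      have "weakly_regular_mod (sqfree_monom ` insert {b} E :: ('v, 'k) mpoly set)
          (map (\<lambda>i. \<Sum>v\<in>S i. var v) is)"
      proof (rule less.hyps[OF card, where c = c])
        fix j assume j: "j \<in> set is"
        show "{c j} \<notin> insert {b} E"
          using bc[OF j] less.prems(4)[OF j] by auto
        fix y assume "y \<in> insert {b} E" "c j \<in> y"
        then show "y \<subseteq> S j"
          using bc[OF j] less.prems(5)[OF j] by auto
      qed (fact less.prems)+
      then show "weakly_regular_mod (insert (var b) (sqfree_monom ` E) :: ('v, 'k) mpoly set)
          (map (\<lambda>i. \<Sum>v\<in>S i. var v) is)"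
        by (simp add: sqfree_monom_def)
    qed
  next
    case False
    \<comment> \<open>Dividing by \<open>c i\<close> can only spoil edges through
      \<open>c i\<close>; each of these contains another singleton edge, which stays in the
      support.\<close>
    have "shift (c i) g \<in> ideal_gen (sqfree_monom ` E)"
      if i: "i \<in> set is" and g: "g \<in> ideal_gen (sqfree_monom ` E)"
      for i and g :: "('v, 'k) mpoly"
      unfolding ideal_gen_sqfree_monom nonface_ideal_def
    proof clarify
      fix m assume "m \<in> Poly_Mapping.keys (shift (c i) g)"
      then have "m + Poly_Mapping.single (c i) 1 \<in> Poly_Mapping.keys g"
        by (simp add: in_keys_iff lookup_shift)
      then obtain e where e: "e \<in> E" "e \<subseteq> insert (c i) (Poly_Mapping.keys m)"
        using g by (auto simp: ideal_gen_sqfree_monom nonface_ideal_def keys_add_nat)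
      show "\<exists>e\<in>E. e \<subseteq> Poly_Mapping.keys m"
      proof (cases "c i \<in> e")
        case True
        then obtain b where "b \<in> e" "b \<noteq> c i" "{b} \<in> E"
          using False i e(1) by blast
        then show ?thesis
          using e(2) by (intro bexI[of _ "{b}"]) auto
      next
        case False
        then show ?thesis
          using e by blast
      qed
    qed
    then show ?thesis
      using less.prems(1-3) by (intro weakly_regular_mod_shift_stable)
  qed
qed

section \<open>Edge ideals, the maximal ideal and depth\<close>

lemma edge_ideal_eq:
  fixes E :: "'v set set"
  assumes "simple_graph E"
  shows "edge_ideal E = (ideal_gen (sqfree_monom ` E) :: ('v, 'k::comm_ring_1) mpoly set)"
proof -
  have pair: "sqfree_monom {u, v} = (var u * var v :: ('v, 'k) mpoly)" if "{u, v} \<in> E" for u v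
  proof -
    \<comment> \<open>For a loop, the product over the set \<open>{u, v}\<close> would have only one
      factor.\<close>
    have "u \<noteq> v"
      using assms that by (auto simp: simple_graph_def)
    then show ?thesis
      by (simp add: sqfree_monom_def)
  qed
  have "{var u * var v |u v. {u, v} \<in> E} = (sqfree_monom ` E :: ('v, 'k) mpoly set)"
  proof (intro equalityI subsetI)
    fix x :: "('v, 'k) mpoly"
    assume "x \<in> sqfree_monom ` E"
    then obtain e where e: "e \<in> E" "x = sqfree_monom e"
      by blast
    then obtain u v where "e = {u, v}"
      using assms by (auto simp: simple_graph_def card_2_iff)
    with e pair show "x \<in> {var u * var v |u v. {u, v} \<in> E}"
      by blast
  qed (auto simp flip: pair)
  then show ?thesis
    by (simp add: edge_ideal_def)
qed

text \<open>Links the generating sets of the induction to the ideal passed to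
  \<open>regular_seq_mod\<close>.\<close>

lemma ideal_gen_Un_ideal_gen: "ideal_gen (ideal_gen J \<union> T) = ideal_gen (J \<union> T)"
proof
  have "ideal_gen J \<subseteq> ideal_gen (J \<union> T)"
    by (auto simp: ideal_gen_subset_iff intro: ideal_gen_superset)
  then show "ideal_gen (ideal_gen J \<union> T) \<subseteq> ideal_gen (J \<union> T)"
    by (auto simp: ideal_gen_subset_iff intro: ideal_gen_superset)
  show "ideal_gen (J \<union> T) \<subseteq> ideal_gen (ideal_gen J \<union> T)"
    by (auto simp: ideal_gen_subset_iff intro: ideal_gen_superset)
qed

lemma max_ideal_eq:
  "(max_ideal :: ('v::finite, 'k::comm_ring_1) mpoly set) = nonface_ideal (range (\<lambda>v. {v}))"
proof -
  have "range var = (sqfree_monom ` range (\<lambda>v. {v}) :: ('v, 'k) mpoly set)"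
    by (simp add: image_image sqfree_monom_def)
  then show ?thesis
    by (simp add: max_ideal_def ideal_gen_sqfree_monom)
qed

lemma max_ideal_neq_UNIV: "(max_ideal :: ('v::finite, 'k::comm_ring_1) mpoly set) \<noteq> UNIV"
proof
  assume "(max_ideal :: ('v, 'k) mpoly set) = UNIV"
  then have "(1 :: ('v, 'k) mpoly) \<in> nonface_ideal (range (\<lambda>v. {v}))"
    by (simp add: max_ideal_eq)
  then show False
    by (simp add: nonface_ideal_def)
qed

lemma edge_ideal_subset_max_ideal: "edge_ideal E \<subseteq> max_ideal"
  unfolding edge_ideal_def max_ideal_def ideal_gen_subset_iff
  by clarify (intro ideal_gen_mult ideal_gen_superset rangeI)

lemma sum_var_mem_max_ideal: "(\<Sum>v\<in>S. var v) \<in> max_ideal"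
  unfolding max_ideal_def ideal_gen_def
  by (intro module.span_sum[OF module_mult] module.span_base[OF module_mult] rangeI)

text \<open>Every edge through \<open>c i\<close> lies in the closed neighbourhood of
  \<open>c i\<close>, so the packing lemma applies; properness holds because everything lies in
  \<open>max_ideal\<close>.\<close>

lemma depth_quot_edge_ideal_ge:
  fixes E :: "'v::finite set set" and c :: "nat \<Rightarrow> 'v"
  assumes E: "simple_graph E"
    and disj: "disjoint_family_on (\<lambda>i. insert (c i) {x. {c i, x} \<in> E}) {..<r}"
  shows "depth_quot (edge_ideal E :: ('v, 'k::field) mpoly set) \<ge> enat r"
proof -
  define S where "S i = insert (c i) {x. {c i, x} \<in> E}" for i
  define fs :: "('v, 'k) mpoly list" where "fs = map (\<lambda>i. \<Sum>v\<in>S i. var v) [0..<r]"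
  have "weakly_regular_mod (sqfree_monom ` E) fs"
    unfolding fs_def
  proof (rule weakly_regular_mod_packing[where c = c])
    show "disjoint_family_on S (set [0..<r])"
      using disj by (simp add: S_def[abs_def] atLeast0LessThan)
    fix i
    show "c i \<in> S i"
      by (simp add: S_def)
    show "{c i} \<notin> E"
      using E by (auto simp: simple_graph_def)
    show "e \<subseteq> S i" if e: "e \<in> E" "c i \<in> e" for e
    proof -
      have "card e = 2"
        using E e by (simp add: simple_graph_def)
      then obtain x where "e = {c i, x}"
        using e(2) unfolding card_2_iff by blast
      with e show ?thesis
        by (auto simp: S_def)
    qed
  qed simp
  moreover have fs_max: "set fs \<subseteq> max_ideal"
    by (auto simp: fs_def sum_var_mem_max_ideal)
  moreover have "ideal_gen (edge_ideal E \<union> set fs) \<subseteq> max_ideal"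
    using edge_ideal_subset_max_ideal fs_max
    by (simp add: max_ideal_def ideal_gen_subset_iff)
  ultimately have "regular_seq_mod (edge_ideal E) fs"
    using max_ideal_neq_UNIV unfolding regular_seq_mod_def weakly_regular_mod_def
    by (metis edge_ideal_eq[OF E] ideal_gen_Un_ideal_gen top.extremum_uniqueI)
  then have "enat (length fs) \<le> depth_quot (edge_ideal E :: ('v, 'k) mpoly set)"
    unfolding depth_quot_def using fs_max by (intro SUP_upper) simp
  then show ?thesis
    by (simp add: fs_def)
qed

section \<open>Distances in a connected graph\<close>

lemma graph_dist_le: "is_path E u p v \<Longrightarrow> graph_dist E u v \<le> length p - 1"
  unfolding graph_dist_def by (rule Least_le) blast

lemma shortest_path_exists:
  assumes "connected_graph E"
  obtains p where "is_path E u p v" and "length p = Suc (graph_dist E u v)"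
proof -
  have "\<exists>l p. is_path E u p v \<and> l = length p - 1"
    using assms by (auto simp: connected_graph_def)
  from LeastI_ex[OF this] obtain p where p: "is_path E u p v" "graph_dist E u v = length p - 1"
    unfolding graph_dist_def by blast
  then show thesis
    by (intro that[of p]) (auto simp: is_path_def)
qed

text \<open>Paths have distinct vertices, so a shortest path to \<open>x\<close> is extended by
  \<open>y\<close> only if it avoids \<open>y\<close>; otherwise it is cut off at
  \<open>y\<close>.\<close>

lemma graph_dist_edge:
  assumes "connected_graph E" and "{x, y} \<in> E"
  shows "graph_dist E u y \<le> Suc (graph_dist E u x)"
proof -
  obtain p where p: "is_path E u p x" "length p = Suc (graph_dist E u x)"
    using shortest_path_exists[OF assms(1)] .
  show ?thesis
  proof (cases "y \<in> set p")
    case True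
    then obtain q r where pqr: "p = q @ y # r"
      by (auto dest: split_list)
    then have "is_path E u (q @ [y]) y"
      using p(1) by (auto simp: is_path_def successively_append_iff hd_append split: if_splits)
    from graph_dist_le[OF this] show ?thesis
      using p(2) pqr by simp
  next
    case False
    then have "is_path E u (p @ [y]) y"
      using p(1) assms(2) by (auto simp: is_path_def successively_append_iff)
    from graph_dist_le[OF this] show ?thesis
      using p(2) by simp
  qed
qed

text \<open>The vertex before \<open>v\<close> on a shortest path has distance exactly one less: at
  most by the shortened path, at least by \<open>graph_dist_edge\<close>.\<close>

lemma graph_dist_attains:
  assumes "connected_graph E" and "k \<le> graph_dist E u v"
  shows "\<exists>x. graph_dist E u x = k"
  using assms(2)
proof (induction "graph_dist E u v" arbitrary: v)
  case (Suc n)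
  obtain p where p: "is_path E u p v" "length p = Suc (Suc n)"
    using shortest_path_exists[OF assms(1), of u v] Suc.hyps(2) by metis
  obtain q' where q': "p = q' @ [v]"
    using p(1) by (metis is_path_def append_butlast_last_id)
  moreover have "q' \<noteq> []"
    using p(2) q' by auto
  ultimately obtain q x where q: "p = q @ [x, v]"
    by (cases q' rule: rev_cases) auto
  have "is_path E u (q @ [x]) x"
    using p(1) q by (auto simp: is_path_def successively_append_iff hd_append split: if_splits)
  from graph_dist_le[OF this] have le: "graph_dist E u x \<le> n"
    using p(2) q by simp
  have "{x, v} \<in> E"
    using p(1) q by (auto simp: is_path_def successively_append_iff)
  from graph_dist_edge[OF assms(1) this, of u] le Suc.hyps(2) have "n = graph_dist E u x"
    by simp
  with Suc.hyps(1)[of x] Suc.hyps(2) Suc.prems show ?case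
    by (cases "k = Suc n") auto
qed auto

theorem theorem3p1:
  fixes E :: "'v::finite set set" and u v :: 'v and d :: nat
  assumes "simple_graph E"
    and "connected_graph E"
    and "graph_dist E u v = d"
  shows "depth_quot (edge_ideal E :: ('v, 'k::field) mpoly set) \<ge> enat (nat \<lceil>(real d + 1) / 3\<rceil>)"
proof -
  let ?r = "nat \<lceil>(real d + 1) / 3\<rceil>"
  \<comment> \<open>Any vertex at distance \<open>3 * i\<close> will do; the choices need not lie on
    one path.\<close>
  define c where "c i = (SOME x. graph_dist E u x = 3 * i)" for i
  have c: "graph_dist E u (c i) = 3 * i" if "i < ?r" for i
  proof -
    \<comment> \<open>The bound on \<open>i\<close> says \<open>3 * i < d + 1\<close>.\<close>
    have "3 * i \<le> graph_dist E u v"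
      using that assms(3) by (simp add: zless_nat_eq_int_zless less_ceiling_iff)
    from graph_dist_attains[OF assms(2) this] show ?thesis
      unfolding c_def by (rule someI_ex)
  qed
  have near: "graph_dist E u x \<le> Suc (graph_dist E u y) \<and> graph_dist E u y \<le> Suc (graph_dist E u x)"
    if "x \<in> insert y {x. {y, x} \<in> E}" for x y
    using that graph_dist_edge[OF assms(2), of x y u] graph_dist_edge[OF assms(2), of y x u]
    by (auto simp: insert_commute)
  \<comment> \<open>A common vertex \<open>x\<close> forces \<open>3 * i\<close> and
    \<open>3 * j\<close> to differ by at most \<open>2\<close>.\<close>
  have "i = j"
    if "i < ?r" "j < ?r" "x \<in> insert (c i) {x. {c i, x} \<in> E}" "x \<in> insert (c j) {x. {c j, x} \<in> E}"
    for i j x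
    using near[OF that(3)] near[OF that(4)] c[OF that(1)] c[OF that(2)] by linarith
  then have "disjoint_family_on (\<lambda>i. insert (c i) {x. {c i, x} \<in> E}) {..<?r}"
    unfolding disjoint_family_on_def by blast
  with assms(1) show ?thesis
    by (rule depth_quot_edge_ideal_ge)
qed

end
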